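(* Let $\theta$ be an ergodic aperiodic probability preserving transformation of a Lebesgue space $(X,\Sigma,\mu)$, let $Tf=f\circ\theta$, and fix $r\in(0,1)$. Then for any $1\le p<1/r$ there is a dense $G_\delta$ subset $\mathcal F\subset L^p(X,\mu)$ such that for every $h\in\mathcal F$, $\limsup_{n\to\infty}\frac{|T^nh|}{n^r}=\infty$ a.e.
   Context: Aperiodic means that the set of $x\in X$ with $\theta^n x=x$ for some $n\ge1$ has measure zero. $L^p(X,\mu)$ carries its usual norm topology. *)

theory Defs
  imports "HOL-Probability.Probability"
begin

section \<open>Lebesgue spaces\<close>

text \<open>A Lebesgue space in the sense of Rokhlin: a complete probability space that is isomorphic
  modulo null sets to an interval with Lebesgue measure together with at most countably many
  atoms. In \<open>lebesgue_space\<close> below, \<open>A\<close> is the set of atoms, and \<open>N\<close> and \<open>N'\<close> are the null sets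
  discarded on the two sides; the case \<open>c = 0\<close> is the purely atomic one.\<close>

definition measure_isomorphism :: "'a measure \<Rightarrow> 'b measure \<Rightarrow> ('a \<Rightarrow> 'b) \<Rightarrow> bool" where
  "measure_isomorphism M N f \<longleftrightarrow>
     bij_betw f (space M) (space N) \<and>
     f \<in> measurable M N \<and>
     the_inv_into (space M) f \<in> measurable N M \<and>
     distr M N f = N"

definition lebesgue_space :: "'a measure \<Rightarrow> bool" where
  "lebesgue_space M \<longleftrightarrow>
     prob_space M \<and> complete_measure M \<and>
     (\<exists>A N N' f. \<exists>c::real.
        countable A \<and> A \<subseteq> space M \<and> (\<forall>a\<in>A. {a} \<in> sets M \<and> measure M {a} > 0) \<and>
        N \<in> null_sets M \<and> N' \<in> null_sets lebesgue \<and> 0 \<le> c \<and>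
        measure_isomorphism
          (restrict_space M (space M - A - N)) (restrict_space lebesgue ({0..c} - N')) f)"


section \<open>Measure preserving transformations\<close>

text \<open>Transformations are not assumed to be invertible.\<close>

definition measure_preserving :: "'a measure \<Rightarrow> ('a \<Rightarrow> 'a) \<Rightarrow> bool" where
  "measure_preserving M \<theta> \<longleftrightarrow>
     \<theta> \<in> measurable M M \<and> (\<forall>A\<in>sets M. emeasure M (\<theta> -` A \<inter> space M) = emeasure M A)"

definition ergodic :: "'a measure \<Rightarrow> ('a \<Rightarrow> 'a) \<Rightarrow> bool" where
  "ergodic M \<theta> \<longleftrightarrow>
     (\<forall>A\<in>sets M. \<theta> -` A \<inter> space M = A \<longrightarrow> A \<in> null_sets M \<or> space M - A \<in> null_sets M)"

definition aperiodic :: "'a measure \<Rightarrow> ('a \<Rightarrow> 'a) \<Rightarrow> bool" where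
  "aperiodic M \<theta> \<longleftrightarrow> {x \<in> space M. \<exists>n\<ge>1. (\<theta> ^^ n) x = x} \<in> null_sets M"

text \<open>The operator $T$, acting on functions rather than on their classes in $L^p$.\<close>

definition koopman :: "('a \<Rightarrow> 'a) \<Rightarrow> ('a \<Rightarrow> 'b) \<Rightarrow> 'a \<Rightarrow> 'b" where
  "koopman \<theta> f = f \<circ> \<theta>"


section \<open>The space $L^p$\<close>

text \<open>Elements of \<open>Lp p M\<close> are equivalence classes, modulo almost everywhere equality, of
  \<open>p\<close>-integrable functions. The distance of two classes is computed on chosen representatives;
  \<open>Lp_dist_eq\<close> shows that the choice is irrelevant.\<close>

definition Lp_fun :: "real \<Rightarrow> 'a measure \<Rightarrow> ('a \<Rightarrow> 'b::real_normed_vector) set" where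
  "Lp_fun p M = {f \<in> borel_measurable M. integrable M (\<lambda>x. norm (f x) powr p)}"

definition AE_rel :: "real \<Rightarrow> 'a measure \<Rightarrow> (('a \<Rightarrow> 'b::real_normed_vector) \<times> ('a \<Rightarrow> 'b)) set" where
  "AE_rel p M = {(f, g). f \<in> Lp_fun p M \<and> g \<in> Lp_fun p M \<and> (AE x in M. f x = g x)}"

definition Lp :: "real \<Rightarrow> 'a measure \<Rightarrow> ('a \<Rightarrow> 'b::real_normed_vector) set set" where
  "Lp p M = Lp_fun p M // AE_rel p M"

definition Lp_norm :: "real \<Rightarrow> 'a measure \<Rightarrow> ('a \<Rightarrow> 'b::real_normed_vector) \<Rightarrow> real" where
  "Lp_norm p M f = (\<integral>x. norm (f x) powr p \<partial>M) powr (1 / p)"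

definition Lp_dist ::
    "real \<Rightarrow> 'a measure \<Rightarrow> ('a \<Rightarrow> 'b::real_normed_vector) set \<Rightarrow> ('a \<Rightarrow> 'b) set \<Rightarrow> real" where
  "Lp_dist p M u v = Lp_norm p M (\<lambda>x. (SOME f. f \<in> u) x - (SOME g. g \<in> v) x)"

definition Lp_topology :: "real \<Rightarrow> 'a measure \<Rightarrow> ('a \<Rightarrow> 'b::real_normed_vector) set topology" where
  "Lp_topology p M = Metric_space.mtopology (Lp p M) (Lp_dist p M)"

lemma Lp_norm_cong_AE:
  fixes f g :: "'a \<Rightarrow> 'b::real_normed_vector"
  assumes "f \<in> borel_measurable M" "g \<in> borel_measurable M" "AE x in M. f x = g x"
  shows "Lp_norm p M f = Lp_norm p M g"
proof -
  have "(\<integral>x. norm (f x) powr p \<partial>M) = (\<integral>x. norm (g x) powr p \<partial>M)"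
    by (rule integral_cong_AE) (use assms in auto)
  then show ?thesis by (simp add: Lp_norm_def)
qed

lemma Lp_norm_nonneg: "0 \<le> Lp_norm p M f"
  by (simp add: Lp_norm_def)

lemma Lp_norm_powr:
  assumes "1 \<le> p"
  shows "Lp_norm p M f powr p = (\<integral>x. norm (f x) powr p \<partial>M)"
proof -
  have "0 \<le> (\<integral>x. norm (f x) powr p \<partial>M)"
    by (rule integral_nonneg_AE) simp
  then show ?thesis
    using assms by (simp add: Lp_norm_def powr_powr)
qed

lemma Lp_norm_eq_0_iff:
  fixes f :: "'a \<Rightarrow> 'b::real_normed_vector"
  assumes "1 \<le> p" "f \<in> Lp_fun p M"
  shows "Lp_norm p M f = 0 \<longleftrightarrow> (AE x in M. f x = 0)"
proof -
  have "Lp_norm p M f = 0 \<longleftrightarrow> (\<integral>x. norm (f x) powr p \<partial>M) = 0"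
    by (simp add: Lp_norm_def)
  also have "\<dots> \<longleftrightarrow> (AE x in M. norm (f x) powr p = 0)"
    by (rule integral_nonneg_eq_0_iff_AE) (use assms in \<open>auto simp: Lp_fun_def\<close>)
  finally show ?thesis by simp
qed

lemma powr_convex_comb:
  fixes s t u p :: real
  assumes "0 \<le> s" "0 \<le> t" "0 < u" "u < 1" "1 \<le> p"
  shows "(u * s + (1 - u) * t) powr p \<le> u * s powr p + (1 - u) * t powr p"
proof -
  have le: "v powr p \<le> v" if "0 < v" "v < 1" for v :: real
    using powr_mono'[of 1 p v] that assms by simp
  consider "s = 0" | "t = 0" | "0 < s" "0 < t" using assms by linarith
  then show ?thesis
  proof cases
    case 1
    then show ?thesis
      using le[of "1 - u"] assms by (simp add: powr_mult mult_right_mono)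
  next
    case 2
    then show ?thesis
      using le[of u] assms by (simp add: powr_mult mult_right_mono)
  next
    case 3
    then show ?thesis
      using convex_onD[OF powr_convex[OF \<open>1 \<le> p\<close>], of "1 - u" s t] assms by simp
  qed
qed

text \<open>Minkowski's inequality.\<close>

lemma Lp_minkowski:
  fixes f g :: "'a \<Rightarrow> 'b::{real_normed_vector, second_countable_topology}"
  assumes p: "1 \<le> p" and f: "f \<in> Lp_fun p M" and g: "g \<in> Lp_fun p M"
  shows "(\<lambda>x. f x + g x) \<in> Lp_fun p M"
    and "Lp_norm p M (\<lambda>x. f x + g x) \<le> Lp_norm p M f + Lp_norm p M g"
proof -
  have meas [measurable]: "f \<in> borel_measurable M" "g \<in> borel_measurable M"
    and int [simp]: "integrable M (\<lambda>x. norm (f x) powr p)" "integrable M (\<lambda>x. norm (g x) powr p)"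
    using f g by (auto simp: Lp_fun_def)
  have pt: "norm (f x + g x) powr p \<le>
      (a + b) powr p * (a / (a + b) * (norm (f x) powr p / a powr p)
        + b / (a + b) * (norm (g x) powr p / b powr p))"
    if ab: "0 < a" "0 < b" for a b x
  proof -
    have u: "1 - a / (a + b) = b / (a + b)" using ab by (simp add: field_simps)
    have "norm (f x + g x) \<le>
        (a + b) * (a / (a + b) * (norm (f x) / a) + (1 - a / (a + b)) * (norm (g x) / b))"
      unfolding u using ab norm_triangle_ineq[of "f x" "g x"]
      by (simp add: distrib_left)
    then have "norm (f x + g x) powr p \<le>
        ((a + b) * (a / (a + b) * (norm (f x) / a) + (1 - a / (a + b)) * (norm (g x) / b))) powr p"
      using p by (intro powr_mono2) auto
    also have "\<dots> = (a + b) powr p *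
        (a / (a + b) * (norm (f x) / a) + (1 - a / (a + b)) * (norm (g x) / b)) powr p"
      using ab unfolding u by (intro powr_mult)
    also have "\<dots> \<le> (a + b) powr p *
        (a / (a + b) * (norm (f x) / a) powr p + (1 - a / (a + b)) * (norm (g x) / b) powr p)"
      using ab p by (intro mult_left_mono powr_convex_comb) auto
    finally show ?thesis
      unfolding u using ab by (simp add: powr_divide)
  qed
  have intfg: "integrable M (\<lambda>x. norm (f x + g x) powr p)"
    by (rule Bochner_Integration.integrable_bound[where f =
          "\<lambda>x. (1 + 1) powr p * (1 / (1 + 1) * (norm (f x) powr p / 1 powr p)
             + 1 / (1 + 1) * (norm (g x) powr p / 1 powr p))"])
      (use pt[of 1 1] in \<open>auto intro!: AE_I2 order_trans[OF _ abs_ge_self]\<close>)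
  then show "(\<lambda>x. f x + g x) \<in> Lp_fun p M"
    by (simp add: Lp_fun_def)
  let ?a = "Lp_norm p M f" and ?b = "Lp_norm p M g"
  consider "?a = 0" | "?b = 0" | "0 < ?a" "0 < ?b"
    using Lp_norm_nonneg[of p M f] Lp_norm_nonneg[of p M g] by linarith
  then show "Lp_norm p M (\<lambda>x. f x + g x) \<le> ?a + ?b"
  proof cases
    case 1
    then have "AE x in M. f x + g x = g x"
      using Lp_norm_eq_0_iff[OF p f] by simp
    then have "Lp_norm p M (\<lambda>x. f x + g x) = ?b"
      by (intro Lp_norm_cong_AE) auto
    then show ?thesis using 1 by simp
  next
    case 2
    then have "AE x in M. f x + g x = f x"
      using Lp_norm_eq_0_iff[OF p g] by simp
    then have "Lp_norm p M (\<lambda>x. f x + g x) = ?a"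
      by (intro Lp_norm_cong_AE) auto
    then show ?thesis using 2 by simp
  next
    case 3
    have "Lp_norm p M (\<lambda>x. f x + g x) powr p = (\<integral>x. norm (f x + g x) powr p \<partial>M)"
      by (rule Lp_norm_powr[OF p])
    also have "\<dots> \<le> (\<integral>x. (?a + ?b) powr p * (?a / (?a + ?b) * (norm (f x) powr p / ?a powr p)
        + ?b / (?a + ?b) * (norm (g x) powr p / ?b powr p)) \<partial>M)"
      by (rule integral_mono) (use pt[OF 3] intfg in auto)
    also have "\<dots> = (?a + ?b) powr p * (?a / (?a + ?b) * (?a powr p / ?a powr p)
        + ?b / (?a + ?b) * (?b powr p / ?b powr p))"
      by (simp add: Lp_norm_powr[OF p])
    also have "\<dots> = (?a + ?b) powr p"
      using 3 by (simp add: add_divide_distrib[symmetric])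
    finally show ?thesis
      using p 3 by (meson add_nonneg_nonneg less_imp_le linorder_not_le powr_less_mono2
          order_less_le_trans zero_less_one)
  qed
qed

lemma Lp_fun_minus:
  fixes f g :: "'a \<Rightarrow> 'b::{real_normed_vector, second_countable_topology}"
  assumes "1 \<le> p" "f \<in> Lp_fun p M" "g \<in> Lp_fun p M"
  shows "(\<lambda>x. f x - g x) \<in> Lp_fun p M"
proof -
  have "(\<lambda>x. - g x) \<in> Lp_fun p M"
    using assms(3) by (auto simp: Lp_fun_def)
  from Lp_minkowski(1)[OF assms(1,2) this] show ?thesis by simp
qed

lemma equiv_AE_rel: "equiv (Lp_fun p M) (AE_rel p M)"
proof (rule equivI)
  show "trans (AE_rel p M)"
    unfolding AE_rel_def
    by (rule transI) (auto elim!: eventually_elim2)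
qed (auto simp: AE_rel_def refl_on_def sym_def elim: eventually_mono)

lemma Lp_class_subset: "u \<in> Lp p M \<Longrightarrow> u \<subseteq> Lp_fun p M"
  unfolding Lp_def using equiv_AE_rel by (rule in_quotient_imp_subset)

lemma Lp_class_AE: "u \<in> Lp p M \<Longrightarrow> f \<in> u \<Longrightarrow> g \<in> u \<Longrightarrow> AE x in M. f x = g x"
  using quotient_eq_iff[OF equiv_AE_rel, of u p M u f g] by (auto simp: Lp_def AE_rel_def)

lemma Lp_class_nonempty: "u \<in> Lp p M \<Longrightarrow> \<exists>f. f \<in> u"
  using in_quotient_imp_non_empty[OF equiv_AE_rel] unfolding Lp_def by blast

lemma Lp_dist_eq:
  fixes f g :: "'a \<Rightarrow> 'b::{real_normed_vector, second_countable_topology}"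
  assumes "u \<in> Lp p M" "v \<in> Lp p M" "f \<in> u" "g \<in> v"
  shows "Lp_dist p M u v = Lp_norm p M (\<lambda>x. f x - g x)"
proof -
  let ?f = "SOME f. f \<in> u" and ?g = "SOME g. g \<in> v"
  have fg: "?f \<in> u" "?g \<in> v"
    using someI[of "\<lambda>f. f \<in> u", OF assms(3)] someI[of "\<lambda>g. g \<in> v", OF assms(4)] by simp_all
  have meas [measurable]: "?f \<in> borel_measurable M" "?g \<in> borel_measurable M"
      "f \<in> borel_measurable M" "g \<in> borel_measurable M"
    using fg assms Lp_class_subset by (auto simp: Lp_fun_def)
  have "AE x in M. ?f x = f x" "AE x in M. ?g x = g x"
    using Lp_class_AE fg assms by blast+
  then have "AE x in M. ?f x - ?g x = f x - g x" by eventually_elim simp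
  then show ?thesis
    unfolding Lp_dist_def by (intro Lp_norm_cong_AE) auto
qed

lemma Metric_space_Lp:
  assumes p: "1 \<le> p"
  shows "Metric_space (Lp p M :: ('a \<Rightarrow> 'b::{real_normed_vector, second_countable_topology}) set set)
           (Lp_dist p M)"
proof
  fix u v w :: "('a \<Rightarrow> 'b) set"
  show "0 \<le> Lp_dist p M u v"
    by (simp add: Lp_dist_def Lp_norm_nonneg)
  show "Lp_dist p M u v = Lp_dist p M v u"
    by (simp add: Lp_dist_def Lp_norm_def norm_minus_commute)
  show "Lp_dist p M u v = 0 \<longleftrightarrow> u = v" if uv: "u \<in> Lp p M" "v \<in> Lp p M"
  proof -
    obtain f g where fg: "f \<in> u" "g \<in> v"
      using uv Lp_class_nonempty by blast
    then have L: "f \<in> Lp_fun p M" "g \<in> Lp_fun p M"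
      using uv Lp_class_subset by blast+
    have "Lp_dist p M u v = 0 \<longleftrightarrow> (AE x in M. f x - g x = 0)"
      using Lp_norm_eq_0_iff[OF p Lp_fun_minus[OF p L]] Lp_dist_eq[OF uv fg] by simp
    also have "\<dots> \<longleftrightarrow> (f, g) \<in> AE_rel p M"
      using L by (simp add: AE_rel_def)
    also have "\<dots> \<longleftrightarrow> u = v"
      using quotient_eq_iff[OF equiv_AE_rel] uv fg unfolding Lp_def by metis
    finally show ?thesis .
  qed
  show "Lp_dist p M u w \<le> Lp_dist p M u v + Lp_dist p M v w"
    if uvw: "u \<in> Lp p M" "v \<in> Lp p M" "w \<in> Lp p M"
  proof -
    obtain f g h where fgh: "f \<in> u" "g \<in> v" "h \<in> w"
      using uvw[THEN Lp_class_nonempty] by blast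
    then have L: "f \<in> Lp_fun p M" "g \<in> Lp_fun p M" "h \<in> Lp_fun p M"
      using uvw Lp_class_subset by blast+
    show ?thesis
      using Lp_minkowski(2)[OF p Lp_fun_minus[OF p L(1,2)] Lp_fun_minus[OF p L(2,3)]]
        Lp_dist_eq[OF uvw(1,2) fgh(1,2)] Lp_dist_eq[OF uvw(2,3) fgh(2,3)]
        Lp_dist_eq[OF uvw(1,3) fgh(1,3)] by simp
  qed
qed

lemma topspace_Lp_topology:
  assumes "1 \<le> p"
  shows "topspace (Lp_topology p M :: ('a \<Rightarrow> 'b::{real_normed_vector, second_countable_topology}) set topology)
           = Lp p M"
  unfolding Lp_topology_def by (rule Metric_space.topspace_mtopology[OF Metric_space_Lp[OF assms]])

end

theory Submission
  imports Defs
begin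

text \<open>
  Let \<open>W K h\<close> be the set of points \<open>x\<close> with \<open>|h (\<theta>\<^sup>n x)| > K n\<^sup>r\<close> for some \<open>n > K\<close> (called
  \<open>outgrows r K h\<close> below). These sets decrease as \<open>K\<close> grows, and on their intersection the limsup is
  infinite. Because they decrease, the apparently weak demand \<open>\<mu> (W K h) > 1 - 1 / (K + 1)\<close> for all
  \<open>K\<close> already forces every \<open>W K h\<close> to have full measure (\<open>outgrows_full\<close>). For a fixed \<open>K\<close> this
  demand involves, up to a small error, only finitely many iterates and strict inequalities, so
  Markov's inequality shows that it is an open condition on \<open>h\<close> (\<open>outgrows_open\<close>). The intersection
  \<open>F\<close> of these open conditions is the required \<open>G\<^sub>\<delta>\<close> set.

  Density of \<open>F\<close> follows once it contains a single function \<open>h\<^sub>0\<close>. Indeed,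
  adding a bounded function to a positive multiple of \<open>h\<^sub>0\<close> does not leave \<open>F\<close>
  (\<open>outgrows_perturb\<close>), and every \<open>g\<close> is the limit in \<open>L\<^sup>p\<close> of its truncations plus \<open>h\<^sub>0 / (n + 1)\<close>
  (\<open>outgrowing_approximates\<close>).

  To find \<open>h\<^sub>0\<close> (\<open>exists_outgrowing\<close>), use Rokhlin's lemma (\<open>rokhlin_tower\<close>): for every \<open>N\<close> some set
  \<open>A\<close> of measure at most \<open>1 / N\<close> is visited within \<open>N\<close> steps from all of the space up to an arbitrarily small
  part. A function
  of size about \<open>k N\<^sup>r\<close> on \<open>A\<close> then exceeds \<open>k n\<^sup>r\<close> at some time \<open>n\<close> along most orbits, while the
  integral of its \<open>p\<close>-th power is about \<open>k\<^sup>p N\<^bsup>rp - 1\<^esup>\<close>. As \<open>rp < 1\<close>, this is at most \<open>2\<^bsup>-k\<^esup>\<close> for large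
  \<open>N\<close>, and one can sum over \<open>k\<close>.

  Rokhlin's lemma is obtained from the hitting times of a set of small positive measure, which also
  works for noninvertible maps. Such sets exist (\<open>lebesgue_space_small_sets\<close>) because an atom
  would return to itself and so consist of a periodic point; hence the space is, modulo null sets,
  an interval of positive length.
\<close>

section \<open>Iterates of a measure preserving transformation\<close>

lemma koopman_funpow: "(koopman \<theta> ^^ n) h x = h ((\<theta> ^^ n) x)"
proof (induction n arbitrary: x)
  case (Suc n)
  have "(koopman \<theta> ^^ Suc n) h x = (koopman \<theta> ^^ n) h (\<theta> x)"
    by (simp add: koopman_def)
  also have "\<dots> = h ((\<theta> ^^ n) (\<theta> x))" by (rule Suc)
  finally show ?case by (simp add: funpow_swap1)
qed simp

locale probability_preserving = prob_space M for M :: "'a measure" +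
  fixes \<theta> :: "'a \<Rightarrow> 'a"
  assumes preserving: "measure_preserving M \<theta>"
begin

lemma iterate_measurable [measurable]: "(\<theta> ^^ n) \<in> measurable M M"
proof (induction n)
  case (Suc n)
  have "\<theta> \<in> measurable M M" using preserving by (simp add: measure_preserving_def)
  with Suc show ?case by (auto intro: measurable_comp)
qed simp

lemma iterate_in_space: "x \<in> space M \<Longrightarrow> (\<theta> ^^ n) x \<in> space M"
  by (rule measurable_space[OF iterate_measurable])

lemma prob_iterate_vimage:
  assumes "A \<in> sets M"
  shows "prob ((\<theta> ^^ n) -` A \<inter> space M) = prob A"
proof (induction n)
  case 0
  then show ?case using sets.sets_into_space[OF assms] by (simp add: Int_absorb2)
next
  case (Suc n)
  let ?B = "(\<theta> ^^ n) -` A \<inter> space M"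
  have "?B \<in> sets M" using assms by measurable
  then have "prob (\<theta> -` ?B \<inter> space M) = prob ?B"
    using preserving unfolding measure_preserving_def by (metis measure_def)
  moreover have "\<theta> -` ?B \<inter> space M = (\<theta> ^^ Suc n) -` A \<inter> space M"
    using iterate_in_space[of _ 1] by (auto simp: funpow_swap1)
  ultimately show ?case using Suc by metis
qed

lemma prob_visit_le:
  assumes "A \<in> sets M" "finite I"
  shows "prob {x \<in> space M. \<exists>i\<in>I. (\<theta> ^^ i) x \<in> A} \<le> real (card I) * prob A"
proof -
  have "{x \<in> space M. \<exists>i\<in>I. (\<theta> ^^ i) x \<in> A} = (\<Union>i\<in>I. (\<theta> ^^ i) -` A \<inter> space M)"
    by auto
  also have "prob \<dots> \<le> (\<Sum>i\<in>I. prob ((\<theta> ^^ i) -` A \<inter> space M))"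
    by (rule finite_measure_subadditive_finite) (use assms in \<open>auto intro: measurable_sets\<close>)
  also have "\<dots> = real (card I) * prob A"
    using assms by (simp add: prob_iterate_vimage)
  finally show ?thesis .
qed

lemma AE_all_iterates:
  assumes "AE x in M. P x"
  shows "AE x in M. \<forall>n. P ((\<theta> ^^ n) x)"
proof -
  obtain N where N: "N \<in> null_sets M" "{x \<in> space M. \<not> P x} \<subseteq> N"
    using assms by (auto elim!: AE_E)
  have "AE x in M. (\<theta> ^^ n) x \<notin> N" for n
  proof (rule AE_I')
    show "(\<theta> ^^ n) -` N \<inter> space M \<in> null_sets M"
    proof (rule null_setsI)
      show "emeasure M ((\<theta> ^^ n) -` N \<inter> space M) = 0"
        using prob_iterate_vimage[OF null_setsD2[OF N(1)], of n] null_setsD1[OF N(1)]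
        by (simp add: emeasure_eq_measure)
      show "(\<theta> ^^ n) -` N \<inter> space M \<in> sets M"
        using N by (auto intro: measurable_sets)
    qed
  qed auto
  then have "AE x in M. \<forall>n. (\<theta> ^^ n) x \<notin> N" by (simp add: AE_all_countable)
  then show ?thesis
    using AE_space by eventually_elim (use N iterate_in_space in blast)
qed

text \<open>Poincare recurrence: if no point of \<open>A\<close> returned to \<open>A\<close>, then its preimages under the iterates
  would be infinitely many disjoint sets of the same positive measure.\<close>

lemma positive_prob_recurs:
  assumes "A \<in> sets M" "0 < prob A"
  shows "\<exists>x\<in>A. \<exists>n\<ge>1. (\<theta> ^^ n) x \<in> A"
proof (rule ccontr)
  assume *: "\<not> ?thesis"
  let ?B = "\<lambda>n. (\<theta> ^^ n) -` A \<inter> space M"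
  have no: "False" if "x \<in> ?B i" "x \<in> ?B j" "i < j" for x i j
  proof -
    have "(\<theta> ^^ (j - i)) ((\<theta> ^^ i) x) = (\<theta> ^^ (j - i + i)) x"
      by (simp only: funpow_add comp_apply)
    then have "(\<theta> ^^ (j - i)) ((\<theta> ^^ i) x) = (\<theta> ^^ j) x" using that(3) by simp
    moreover have "(\<theta> ^^ i) x \<in> A" "1 \<le> j - i" using that by auto
    then have "(\<theta> ^^ (j - i)) ((\<theta> ^^ i) x) \<notin> A" using * by blast
    ultimately show False using that(2) by auto
  qed
  have "disjoint_family ?B"
    unfolding disjoint_family_on_def
  proof (intro ballI impI)
    fix i j :: nat assume "i \<noteq> j"
    then have "i < j \<or> j < i" by auto
    then show "?B i \<inter> ?B j = {}" using no by blast
  qed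
  then have "(\<lambda>n. prob (?B n)) sums prob (\<Union>n. ?B n)"
    by (intro finite_measure_UNION) (use assms in \<open>auto intro: measurable_sets\<close>)
  then have "(\<lambda>n::nat. prob A) \<longlonglongrightarrow> 0"
    using summable_LIMSEQ_zero assms(1) by (auto simp: prob_iterate_vimage sums_iff)
  then show False using assms(2) by (simp add: LIMSEQ_const_iff)
qed

section \<open>Rokhlin towers\<close>

text \<open>The set of points that visit \<open>E\<close> at some time contains its preimage but need not equal it,
  whereas the definition of ergodicity speaks of strictly invariant sets. The set of points that visit \<open>E\<close>
  infinitely often is strictly invariant, and it has the same measure because it is the decreasing
  limit of preimages of the former set.\<close>

lemma ergodic_visits:
  assumes erg: "ergodic M \<theta>" and E [measurable]: "E \<in> sets M" and pos: "0 < prob E"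
  shows "AE x in M. \<exists>n. (\<theta> ^^ n) x \<in> E"
proof -
  \<comment> \<open>The set of points that visit \<open>E\<close> infinitely often is the intersection of the \<open>U m\<close>.\<close>
  define U where "U m = {x \<in> space M. \<exists>n\<ge>m. (\<theta> ^^ n) x \<in> E}" for m
  have U [measurable]: "U m \<in> sets M" for m unfolding U_def by measurable
  have U_shift: "U m = (\<theta> ^^ m) -` U 0 \<inter> space M" for m
  proof -
    have shift: "(\<theta> ^^ n) ((\<theta> ^^ m) x) = (\<theta> ^^ (n + m)) x" for n x
      by (simp only: funpow_add comp_apply)
    have ex_shift: "(\<exists>n\<ge>m. P n) \<longleftrightarrow> (\<exists>n. P (n + m))" for P :: "nat \<Rightarrow> bool"
      by (auto simp: le_iff_add add.commute)
    show ?thesis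
      unfolding U_def vimage_def ex_shift Int_iff mem_Collect_eq shift using iterate_in_space by auto
  qed
  have pU: "prob (U m) = prob (U 0)" for m
    unfolding U_shift[of m] by (rule prob_iterate_vimage[OF U])
  have "decseq U" unfolding decseq_Suc_iff U_def by (blast dest: Suc_leD)
  then have "(\<lambda>m. prob (U m)) \<longlonglongrightarrow> prob (\<Inter>m. U m)"
    by (intro finite_Lim_measure_decseq) auto
  moreover have "(\<lambda>m. prob (U m)) \<longlonglongrightarrow> prob (U 0)"
    by (intro tendsto_eventually always_eventually allI pU)
  ultimately have "prob (\<Inter>m. U m) = prob (U 0)" by (rule LIMSEQ_unique)
  moreover have "prob E \<le> prob (U 0)"
    by (rule finite_measure_mono)
      (use sets.sets_into_space[OF E] in \<open>auto simp: U_def intro!: exI[of _ 0]\<close>)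
  ultimately have "(\<Inter>m. U m) \<notin> null_sets M"
    using pos by (auto simp: emeasure_eq_measure null_sets_def)
  moreover have "\<theta> -` (\<Inter>m. U m) \<inter> space M = (\<Inter>m. U m)"
  proof (intro set_eqI iffI)
    fix x assume x: "x \<in> \<theta> -` (\<Inter>m. U m) \<inter> space M"
    show "x \<in> (\<Inter>m. U m)"
    proof
      fix m
      from x obtain n where "n \<ge> m" "(\<theta> ^^ n) (\<theta> x) \<in> E" by (auto simp: U_def)
      then show "x \<in> U m" using x
        by (auto simp: U_def funpow_swap1 intro!: exI[of _ "Suc n"])
    qed
  next
    fix x assume x: "x \<in> (\<Inter>m. U m)"
    then have xs: "x \<in> space M" by (auto simp: U_def)
    have "\<theta> x \<in> U m" for m
    proof -
      from x obtain n where "n \<ge> Suc m" "(\<theta> ^^ n) x \<in> E" by (auto simp: U_def)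
      then show ?thesis using iterate_in_space[OF xs, of 1]
        by (cases n) (auto simp: U_def funpow_swap1)
    qed
    then show "x \<in> \<theta> -` (\<Inter>m. U m) \<inter> space M" using xs by auto
  qed
  moreover have "(\<Inter>m. U m) \<in> sets M" by measurable
  ultimately have "space M - (\<Inter>m. U m) \<in> null_sets M"
    using erg unfolding ergodic_def by blast
  then show ?thesis by (rule AE_I') (auto simp: U_def)
qed

text \<open>Take \<open>E\<close> of measure less than \<open>\<epsilon> / N\<close> and let \<open>A\<close> consist of the points whose first hitting time of
  \<open>E\<close> is a positive multiple of \<open>N\<close>. Each application of \<open>\<theta>\<close> lowers the hitting time by one until
  \<open>E\<close> is reached, so a point with hitting time at least \<open>N\<close> enters \<open>A\<close> within \<open>N\<close> steps, and the
  points with a smaller hitting time have measure at most \<open>N \<mu>(E)\<close>. For the same reason two visits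
  to \<open>A\<close> are at least \<open>N\<close> steps apart, so the first \<open>N\<close> preimages of \<open>A\<close> are disjoint and the measure
  of \<open>A\<close> is at most \<open>1 / N\<close>.\<close>

lemma rokhlin_tower:
  assumes erg: "ergodic M \<theta>"
    and small: "\<And>\<delta>. 0 < \<delta> \<Longrightarrow> \<exists>E\<in>sets M. 0 < prob E \<and> prob E < \<delta>"
    and N: "0 < N" and e: "0 < \<epsilon>"
  obtains A where "A \<in> sets M" "real N * prob A \<le> 1"
    "1 - \<epsilon> < prob {x \<in> space M. \<exists>i<N. (\<theta> ^^ i) x \<in> A}"
proof -
  obtain E where E [measurable]: "E \<in> sets M" and Epos: "0 < prob E" and "prob E < \<epsilon> / real N"
    using small[of "\<epsilon> / real N"] N e by auto
  then have NE: "real N * prob E < \<epsilon>" using N by (simp add: field_simps)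
  define hit where "hit j = {x \<in> space M. (\<theta> ^^ j) x \<in> E \<and> (\<forall>i<j. (\<theta> ^^ i) x \<notin> E)}" for j
  have [measurable]: "hit j \<in> sets M" for j unfolding hit_def by measurable
  have hit_shift: "(\<theta> ^^ i) x \<in> hit (j - i)" if "x \<in> hit j" "i \<le> j" for x i j
  proof -
    have *: "(\<theta> ^^ k) ((\<theta> ^^ i) x) = (\<theta> ^^ (k + i)) x" for k by (simp add: funpow_add)
    show ?thesis using that iterate_in_space unfolding hit_def by (auto simp: *)
  qed
  have hit_unique: "i = j" if "x \<in> hit i" "x \<in> hit j" for x i j
    using that unfolding hit_def by (metis (mono_tags, lifting) linorder_neqE_nat mem_Collect_eq)
  \<comment> \<open>\<open>Suc k\<close> leaves out the hitting time \<open>0\<close>: a point of \<open>E\<close> itself could return to \<open>E\<close> too early.\<close>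
  define A where "A = (\<Union>k. hit (N * Suc k))"
  have A [measurable]: "A \<in> sets M" unfolding A_def by measurable
  have no: False if xA: "x \<in> A" "(\<theta> ^^ i) x \<in> A" and "0 < i" "i < N" for x i
  proof -
    obtain k l where k: "x \<in> hit (N * Suc k)" and l: "(\<theta> ^^ i) x \<in> hit (N * Suc l)"
      using xA unfolding A_def by blast
    have le: "i \<le> N * Suc k" using \<open>i < N\<close> by simp
    have "N * Suc k - i = N * Suc l"
      using hit_unique[OF hit_shift[OF k le] l] .
    then have "i = N * Suc k - N * Suc l" using le by linarith
    then have "N dvd i" by (metis dvd_diff_nat dvd_triv_left)
    then show False using that by (auto dest: dvd_imp_le)
  qed
  have "disjoint_family_on (\<lambda>i. (\<theta> ^^ i) -` A \<inter> space M) {..<N}"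
  proof -
    have "False" if "(\<theta> ^^ i) x \<in> A" "(\<theta> ^^ j) x \<in> A" "i < j" "j < N" for x i j
    proof -
      have "(\<theta> ^^ (j - i)) ((\<theta> ^^ i) x) = (\<theta> ^^ (j - i + i)) x"
        by (simp only: funpow_add comp_apply)
      then have "(\<theta> ^^ (j - i)) ((\<theta> ^^ i) x) \<in> A" using that(2,3) by simp
      moreover have "0 < j - i" "j - i < N" using that(3,4) by auto
      ultimately show False by (rule no[OF that(1)])
    qed
    then show ?thesis
      unfolding disjoint_family_on_def by (auto, meson linorder_neqE_nat)
  qed
  then have "prob (\<Union>i\<in>{..<N}. (\<theta> ^^ i) -` A \<inter> space M)
      = (\<Sum>i\<in>{..<N}. prob ((\<theta> ^^ i) -` A \<inter> space M))"
    by (intro finite_measure_finite_Union) auto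
  also have "\<dots> = real N * prob A" by (simp add: prob_iterate_vimage)
  finally have NA: "real N * prob A \<le> 1" by (metis prob_le_1)
  let ?C = "{x \<in> space M. \<exists>i<N. (\<theta> ^^ i) x \<in> A}" and ?D = "{x \<in> space M. \<exists>i\<in>{..<N}. (\<theta> ^^ i) x \<in> E}"
  have "AE x in M. x \<in> ?C \<union> ?D"
    using ergodic_visits[OF erg E Epos] AE_space
  proof eventually_elim
    case (elim x)
    define j where "j = (LEAST n. (\<theta> ^^ n) x \<in> E)"
    have j: "x \<in> hit j"
      using elim LeastI_ex[of "\<lambda>n. (\<theta> ^^ n) x \<in> E"] not_less_Least[of _ "\<lambda>n. (\<theta> ^^ n) x \<in> E"]
      by (auto simp: hit_def j_def)
    show ?case
    proof (cases "j < N")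
      case True
      then show ?thesis using j by (auto simp: hit_def)
    next
      case False
      then obtain k where k: "j div N = Suc k"
        using N by (metis div_eq_0_iff not0_implies_Suc not_gr_zero)
      \<comment> \<open>After \<open>j mod N\<close> steps the remaining hitting time is the largest multiple of \<open>N\<close> not
          exceeding \<open>j\<close>.\<close>
      have "(\<theta> ^^ (j mod N)) x \<in> hit (j - j mod N)" by (rule hit_shift[OF j]) simp
      moreover have "j - j mod N = N * Suc k" using k by (metis minus_mod_eq_mult_div)
      ultimately have "(\<theta> ^^ (j mod N)) x \<in> A" by (auto simp: A_def)
      then show ?thesis using elim N by (auto intro!: exI[of _ "j mod N"])
    qed
  qed
  then have "prob (?C \<union> ?D) = 1" by (subst prob_eq_1) auto
  then have "1 = prob (?C \<union> ?D)" by simp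
  also have "\<dots> \<le> prob ?C + prob ?D" by (rule measure_Un_le) auto
  also have "prob ?D \<le> real N * prob E" using prob_visit_le[OF E, of "{..<N}"] by simp
  finally have "1 - \<epsilon> < prob ?C" using NE by linarith
  with A NA show ?thesis by (rule that)
qed

end

section \<open>Sets of small positive measure\<close>

text \<open>Aperiodicity excludes atoms, because a point of positive measure returns to itself. Then the
  interval in the isomorphism has positive length, and its short initial segments pull back to the
  required sets.\<close>

lemma lebesgue_space_small_sets:
  assumes leb: "lebesgue_space M" and pres: "measure_preserving M \<theta>" and ap: "aperiodic M \<theta>"
    and "0 < \<delta>"
  shows "\<exists>E\<in>sets M. 0 < measure M E \<and> measure M E < \<delta>"
proof -
  interpret prob_space M using leb by (simp add: lebesgue_space_def)
  interpret probability_preserving M \<theta> by unfold_locales (rule pres)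
  obtain A N N' f c where A: "A \<subseteq> space M" "\<forall>a\<in>A. {a} \<in> sets M \<and> measure M {a} > 0"
    and N: "N \<in> null_sets M" and N': "N' \<in> null_sets lebesgue" and c: "0 \<le> (c::real)"
    and iso: "measure_isomorphism (restrict_space M (space M - A - N)) (restrict_space lebesgue ({0..c} - N')) f"
    using leb unfolding lebesgue_space_def by blast
  have "A = {}"
  proof (rule ccontr)
    assume "A \<noteq> {}"
    then obtain a where a: "a \<in> A" by blast
    obtain n where "n \<ge> 1" "(\<theta> ^^ n) a = a"
      using positive_prob_recurs[of "{a}"] A a by auto
    then have "{a} \<subseteq> {x \<in> space M. \<exists>n\<ge>1. (\<theta> ^^ n) x = x}" using A a by auto
    then have "{a} \<in> null_sets M"
      using ap A a unfolding aperiodic_def by (metis (no_types, lifting) null_sets_subset)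
    then show False using A a by (auto simp: measure_eq_0_null_sets)
  qed
  define S where "S = space M - N"
  define L where "L = {0..c} - N'"
  have S [measurable]: "S \<in> sets M" unfolding S_def using N by auto
  have L: "L \<in> sets lebesgue" unfolding L_def using N' by auto
  have f: "f \<in> measurable (restrict_space M S) (restrict_space lebesgue L)"
    and d: "distr (restrict_space M S) (restrict_space lebesgue L) f = restrict_space lebesgue L"
    using iso \<open>A = {}\<close> unfolding measure_isomorphism_def S_def L_def by auto
  have spS: "space (restrict_space M S) = S"
    using sets.sets_into_space[OF S] by (simp add: space_restrict_space Int_absorb2)
  have key: "f -` (L \<inter> {0..t}) \<inter> S \<in> sets M \<and> emeasure M (f -` (L \<inter> {0..t}) \<inter> S) = ennreal t"
    if t: "0 \<le> t" "t \<le> c" for t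
  proof -
    let ?B = "L \<inter> {0..t}"
    have B: "?B \<in> sets (restrict_space lebesgue L)"
      using L by (auto simp: sets_restrict_space_iff)
    have m: "f -` ?B \<inter> S \<in> sets (restrict_space M S)"
      using measurable_sets[OF f B] by (simp add: spS)
    have "emeasure M (f -` ?B \<inter> S) = emeasure (restrict_space M S) (f -` ?B \<inter> S)"
      by (rule emeasure_restrict_space[symmetric]) auto
    also have "\<dots> = emeasure (distr (restrict_space M S) (restrict_space lebesgue L) f) ?B"
      using f B by (simp add: emeasure_distr spS)
    also have "\<dots> = emeasure lebesgue ?B"
      unfolding d using L by (intro emeasure_restrict_space) auto
    also have "emeasure lebesgue ?B = emeasure lebesgue ({0..t} - N')"
      using t unfolding L_def by (intro arg_cong[where f = "emeasure lebesgue"]) auto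
    also have "\<dots> = emeasure lebesgue {0..t}"
      using N' by (intro emeasure_Diff_null_set) auto
    also have "\<dots> = ennreal t" using t by simp
    finally have "emeasure M (f -` ?B \<inter> S) = ennreal t" .
    moreover have "f -` ?B \<inter> S \<in> sets M"
      using m sets.sets_into_space[OF S] by (subst (asm) sets_restrict_space_iff) (auto simp: Int_absorb2)
    ultimately show ?thesis by blast
  qed
  have "0 < c"
  proof (rule ccontr)
    assume "\<not> 0 < c"
    then have "c = 0" using c by simp
    have "f ` S \<subseteq> L"
      using measurable_space[OF f] by (auto simp: spS space_restrict_space)
    then have "f -` (L \<inter> {0..c}) \<inter> S = S" unfolding L_def by auto
    then have "emeasure M S = 0" using key[of c] c \<open>c = 0\<close> by simp
    moreover have "emeasure M S = 1"
      unfolding S_def using N by (simp add: emeasure_Diff_null_set emeasure_space_1)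
    ultimately show False by simp
  qed
  define t where "t = min c (\<delta> / 2)"
  have t: "0 < t" "t \<le> c" "t < \<delta>" using \<open>0 < c\<close> \<open>0 < \<delta>\<close> by (auto simp: t_def min_def)
  have "measure M (f -` (L \<inter> {0..t}) \<inter> S) = t"
    using key[of t] t by (simp add: measure_def)
  then show ?thesis using key[of t] t by (intro bexI[of _ "f -` (L \<inter> {0..t}) \<inter> S"]) auto
qed

section \<open>Orbits that outgrow a power\<close>

context probability_preserving
begin

definition outgrows :: "real \<Rightarrow> nat \<Rightarrow> ('a \<Rightarrow> 'b::real_normed_vector) \<Rightarrow> 'a set" where
  "outgrows r K h = {x \<in> space M. \<exists>n>K. real K * real n powr r < norm (h ((\<theta> ^^ n) x))}"

lemma outgrows_measurable [measurable]:
  assumes [measurable]: "h \<in> borel_measurable M"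
  shows "outgrows r K h \<in> sets M"
  unfolding outgrows_def by measurable

lemma outgrows_antimono:
  assumes "K \<le> J"
  shows "outgrows r J h \<subseteq> outgrows r K h"
proof
  fix x assume "x \<in> outgrows r J h"
  then obtain n where n: "x \<in> space M" "n > J" "real J * real n powr r < norm (h ((\<theta> ^^ n) x))"
    by (auto simp: outgrows_def)
  have "real K * real n powr r \<le> real J * real n powr r"
    using assms by (intro mult_right_mono) auto
  then have "K < n" "real K * real n powr r < norm (h ((\<theta> ^^ n) x))" using n assms by linarith+
  then show "x \<in> outgrows r K h" using n(1) unfolding outgrows_def by blast
qed

text \<open>As the sets decrease, each of them contains sets of measure arbitrarily close to \<open>1\<close>.\<close>

lemma outgrows_full:
  assumes h: "h \<in> borel_measurable M"
    and large: "\<And>K. 1 - 1 / real (Suc K) < prob (outgrows r K h)"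
  shows "AE x in M. \<forall>K. x \<in> outgrows r K h"
proof -
  have "prob (outgrows r K h) = 1" for K
  proof (rule antisym[OF prob_le_1])
    have lim: "(\<lambda>J. 1 - 1 / real (Suc J)) \<longlonglongrightarrow> 1 - 0"
      by (intro tendsto_diff tendsto_const lim_1_over_n[THEN LIMSEQ_Suc])
    have "1 - 1 / real (Suc J) \<le> prob (outgrows r K h)" if "J \<ge> K" for J
      using large[of J] finite_measure_mono[OF outgrows_antimono[OF that] outgrows_measurable[OF h]]
      by (rule order_trans[OF less_imp_le])
    then show "1 \<le> prob (outgrows r K h)"
      using LIMSEQ_le_const2[OF lim] by auto
  qed
  then have "AE x in M. x \<in> outgrows r K h" for K
    using prob_eq_1[OF outgrows_measurable[OF h]] by blast
  then show ?thesis by (simp add: AE_all_countable)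
qed

lemma outgrows_limsup:
  assumes "\<forall>K. x \<in> outgrows r K h"
  shows "limsup (\<lambda>n. ereal (norm ((koopman \<theta> ^^ n) h x) / real n powr r)) = \<infinity>"
proof (rule ccontr)
  let ?q = "\<lambda>n. norm (h ((\<theta> ^^ n) x)) / real n powr r"
  assume "\<not> ?thesis"
  then obtain C :: nat where "limsup (\<lambda>n. ereal (?q n)) < ereal (real C)"
    using less_PInf_Ex_of_nat by (auto simp: koopman_funpow)
  then have "\<forall>\<^sub>F n in sequentially. ereal (?q n) < ereal (real C)"
    by (rule Limsup_lessD)
  then obtain m where m: "\<And>n. n \<ge> m \<Longrightarrow> ?q n < real C"
    by (auto simp: eventually_sequentially)
  obtain n where n: "n > max m C" "real (max m C) * real n powr r < norm (h ((\<theta> ^^ n) x))"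
    using assms[rule_format, of "max m C"] unfolding outgrows_def by blast
  then have "0 < real n powr r" by auto
  then have "real (max m C) < ?q n" using n by (simp add: pos_less_divide_eq)
  then show False using m[of n] n(1) by auto
qed

text \<open>A bounded perturbation is absorbed by passing to a larger index: \<open>s J n\<^sup>r - C\<close> is at least
  \<open>K n\<^sup>r\<close> as soon as \<open>s J \<ge> K + C\<close>, since \<open>n\<^sup>r \<ge> 1\<close>.\<close>

lemma outgrows_perturb:
  fixes b :: "'a \<Rightarrow> 'b::real_normed_div_algebra" and h :: "'a \<Rightarrow> real"
  assumes "0 < r" "0 < s" and b: "\<And>x. norm (b x) \<le> C" and x: "\<forall>K. x \<in> outgrows r K h"
  shows "x \<in> outgrows r K (\<lambda>x. b x + of_real (s * h x))"
proof -
  obtain J0 :: nat where J0: "(real K + C) / s \<le> real J0" using real_arch_simple by blast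
  define J where "J = max K J0"
  have J: "K \<le> J" "real K + C \<le> s * real J"
    using J0 \<open>0 < s\<close> by (auto simp: J_def pos_divide_le_eq mult.commute intro: order_trans)
  obtain n where n: "x \<in> space M" "n > J" "real J * real n powr r < \<bar>h ((\<theta> ^^ n) x)\<bar>"
    using x[rule_format, of J] by (auto simp: outgrows_def)
  have n1: "1 \<le> real n powr r" using n \<open>0 < r\<close> by (intro ge_one_powr_ge_zero) auto
  have C: "0 \<le> C" using b norm_ge_zero order_trans by blast
  have "real K * real n powr r + C \<le> (real K + C) * real n powr r"
    using n1 C by (simp add: distrib_right mult_le_cancel_left1)
  also have "\<dots> \<le> s * real J * real n powr r"
    using J n1 by (intro mult_right_mono) auto
  also have "\<dots> < s * \<bar>h ((\<theta> ^^ n) x)\<bar>" using n \<open>0 < s\<close> by (simp add: mult.assoc)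
  also have "\<dots> = norm (of_real (s * h ((\<theta> ^^ n) x)) :: 'b)"
    using \<open>0 < s\<close> by (subst norm_of_real) (simp add: abs_mult)
  also have "\<dots> \<le> norm (b ((\<theta> ^^ n) x) + of_real (s * h ((\<theta> ^^ n) x))) + norm (b ((\<theta> ^^ n) x))"
    by (metis add.commute add_diff_cancel_left' norm_triangle_ineq4)
  finally have "real K * real n powr r < norm (b ((\<theta> ^^ n) x) + of_real (s * h ((\<theta> ^^ n) x)))"
    using b[of "(\<theta> ^^ n) x"] by linarith
  then show ?thesis using n J unfolding outgrows_def by (auto intro!: exI[of _ n])
qed

text \<open>By continuity of the measure, all but a small part of \<open>outgrows r K h\<close> is already detected by
  finitely many times \<open>n\<close>, and with a margin \<open>\<delta>\<close> in the inequality. A function \<open>h'\<close> near \<open>h\<close> differs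
  from it by \<open>\<delta>\<close> or more only on a small set, and few points visit that set at one of these times.\<close>

lemma outgrows_open:
  fixes h :: "'a \<Rightarrow> 'b::{real_normed_vector, second_countable_topology}"
  assumes p: "1 \<le> p" and h: "h \<in> Lp_fun p M" and large: "a < prob (outgrows r K h)"
  shows "\<exists>\<eta>>0. \<forall>h'\<in>Lp_fun p M. Lp_norm p M (\<lambda>x. h x - h' x) < \<eta> \<longrightarrow> a < prob (outgrows r K h')"
proof -
  have [measurable]: "h \<in> borel_measurable M" using h by (simp add: Lp_fun_def)
  define S where "S j = {x \<in> space M. \<exists>n\<in>{K<..K + j}.
      real K * real n powr r + 1 / real (Suc j) < norm (h ((\<theta> ^^ n) x))}" for j
  have [measurable]: "S j \<in> sets M" for j unfolding S_def by measurable
  have "incseq S"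
  proof (rule incseq_SucI, rule subsetI)
    fix j x assume "x \<in> S j"
    then obtain n where "x \<in> space M" "n \<in> {K<..K + j}"
      "real K * real n powr r + 1 / real (Suc j) < norm (h ((\<theta> ^^ n) x))" by (auto simp: S_def)
    moreover have "1 / real (Suc (Suc j)) \<le> 1 / real (Suc j)" by (simp add: frac_le)
    ultimately show "x \<in> S (Suc j)" unfolding S_def by (auto intro!: bexI[of _ n])
  qed
  moreover have "(\<Union>j. S j) = outgrows r K h"
  proof (intro set_eqI iffI)
    fix x assume "x \<in> outgrows r K h"
    then obtain n where n: "x \<in> space M" "n > K" "real K * real n powr r < norm (h ((\<theta> ^^ n) x))"
      by (auto simp: outgrows_def)
    obtain j0 where j0: "1 / real (Suc j0) < norm (h ((\<theta> ^^ n) x)) - real K * real n powr r"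
      using n(3) by (metis diff_gt_0_iff_gt nat_approx_posE)
    have "1 / real (Suc (max n j0)) \<le> 1 / real (Suc j0)" by (simp add: frac_le)
    with j0 n have "x \<in> S (max n j0)" unfolding S_def by (auto intro!: bexI[of _ n])
    then show "x \<in> (\<Union>j. S j)" by blast
  next
    fix x assume "x \<in> (\<Union>j. S j)"
    then obtain j n where n: "x \<in> space M" "n \<in> {K<..K + j}"
      "real K * real n powr r + 1 / real (Suc j) < norm (h ((\<theta> ^^ n) x))" by (auto simp: S_def)
    have "0 < 1 / real (Suc j)" by simp
    then have "real K * real n powr r < norm (h ((\<theta> ^^ n) x))" using n(3) by linarith
    then show "x \<in> outgrows r K h" using n by (auto simp: outgrows_def)
  qed
  ultimately have "(\<lambda>j. prob (S j)) \<longlonglongrightarrow> prob (outgrows r K h)"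
    using finite_Lim_measure_incseq[of S] by (auto simp: image_subset_iff)
  from order_tendstoD(1)[OF this large] obtain j where j: "a < prob (S j)"
    by (auto simp: eventually_sequentially)
  \<comment> \<open>By Markov's inequality, \<open>|h - h'| \<ge> \<delta>\<close> has measure at most \<open>e\<close> if the norm of \<open>h - h'\<close> is
    below \<open>\<delta> e\<^bsup>1/p\<^esup>\<close>. The \<open>j\<close> times in \<open>S j\<close> then cost at most \<open>j e\<close>, less than the room left above \<open>a\<close>.\<close>
  define \<delta> e where "\<delta> = 1 / real (Suc j)" and "e = (prob (S j) - a) / real (Suc j)"
  have de: "0 < \<delta>" "0 < e" using j by (auto simp: \<delta>_def e_def)
  have bound: "a < prob (outgrows r K h')"
    if h': "h' \<in> Lp_fun p M" and close: "Lp_norm p M (\<lambda>x. h x - h' x) < \<delta> * e powr (1 / p)" for h'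
  proof -
    have [measurable]: "h' \<in> borel_measurable M" using h' by (simp add: Lp_fun_def)
    define D where "D = {x \<in> space M. \<delta> powr p \<le> norm (h x - h' x) powr p}"
    have [measurable]: "D \<in> sets M" unfolding D_def by measurable
    have int: "integrable M (\<lambda>x. norm (h x - h' x) powr p)"
      using Lp_fun_minus[OF p h h'] by (simp add: Lp_fun_def)
    have "prob D \<le> (\<integral>x. norm (h x - h' x) powr p \<partial>M) / \<delta> powr p"
      unfolding D_def using de
      by (intro integral_Markov_inequality_measure[where A = "{}", OF int]) auto
    also have "(\<integral>x. norm (h x - h' x) powr p \<partial>M) = Lp_norm p M (\<lambda>x. h x - h' x) powr p"
      by (rule Lp_norm_powr[OF p, symmetric])
    also have "\<dots> \<le> (\<delta> * e powr (1 / p)) powr p"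
      using close p by (intro powr_mono2) (auto simp: Lp_norm_nonneg)
    also have "\<dots> = \<delta> powr p * e" using de p by (simp add: powr_mult powr_powr)
    finally have D: "prob D \<le> e" using de by (simp add: divide_right_mono)
    let ?V = "{x \<in> space M. \<exists>n\<in>{K<..K + j}. (\<theta> ^^ n) x \<in> D}"
    have "S j \<subseteq> outgrows r K h' \<union> ?V"
    proof
      fix x assume "x \<in> S j"
      then obtain n where n: "x \<in> space M" "n \<in> {K<..K + j}"
        "real K * real n powr r + \<delta> < norm (h ((\<theta> ^^ n) x))" by (auto simp: S_def \<delta>_def)
      show "x \<in> outgrows r K h' \<union> ?V"
      proof (cases "(\<theta> ^^ n) x \<in> D")
        case True
        then show ?thesis using n by auto
      next
        case False
        then have "norm (h ((\<theta> ^^ n) x) - h' ((\<theta> ^^ n) x)) < \<delta>"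
          using iterate_in_space[OF n(1), of n] de p
            powr_mono2[of p \<delta> "norm (h ((\<theta> ^^ n) x) - h' ((\<theta> ^^ n) x))"]
          unfolding D_def by (auto simp: not_le[symmetric])
        then have "real K * real n powr r < norm (h' ((\<theta> ^^ n) x))"
          using n(3) norm_triangle_ineq2[of "h ((\<theta> ^^ n) x)" "h' ((\<theta> ^^ n) x)"] by linarith
        then show ?thesis using n by (auto simp: outgrows_def)
      qed
    qed
    then have "prob (S j) \<le> prob (outgrows r K h' \<union> ?V)"
      by (intro finite_measure_mono) auto
    also have "\<dots> \<le> prob (outgrows r K h') + prob ?V"
      by (rule measure_Un_le) auto
    also have "prob ?V \<le> real j * prob D"
      using prob_visit_le[of D "{K<..K + j}"] by simp
    also have "\<dots> \<le> real j * e" using D by (intro mult_left_mono) auto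
    also have "\<dots> < real (Suc j) * e" using de by (intro mult_strict_right_mono) auto
    also have "\<dots> = prob (S j) - a" by (simp add: e_def del: of_nat_Suc)
    finally show ?thesis by linarith
  qed
  show ?thesis by (rule exI[of _ "\<delta> * e powr (1 / p)"]) (use de bound in auto)
qed

section \<open>One function in Lp whose orbits outgrow the power\<close>

text \<open>The function is \<open>(\<Sum>k. c\<^sub>k\<^sup>p 1\<^bsub>A\<^sub>k\<^esub>)\<^bsup>1/p\<^esup>\<close> with \<open>A\<^sub>k\<close> from Rokhlin's lemma for \<open>N\<^sub>k\<close> steps and
  \<open>c\<^sub>k = (k + 1) (2 N\<^sub>k)\<^sup>r\<close>. Taking the root of a sum, instead of summing the \<open>c\<^sub>k 1\<^bsub>A\<^sub>k\<^esub>\<close>, makes the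
  \<open>p\<close>-th power a series that can be integrated termwise, and it still dominates every \<open>c\<^sub>k\<close> on
  \<open>A\<^sub>k\<close>.\<close>

lemma exists_outgrowing:
  assumes tower: "\<And>N \<epsilon>. 0 < N \<Longrightarrow> 0 < \<epsilon> \<Longrightarrow> \<exists>A\<in>sets M. real N * prob A \<le> 1 \<and>
      1 - \<epsilon> < prob {x \<in> space M. \<exists>i<N. (\<theta> ^^ i) x \<in> A}"
    and r: "0 < r" and p: "1 \<le> p" and rp: "r * p < 1"
  obtains h :: "'a \<Rightarrow> real" where "h \<in> Lp_fun p M" "AE x in M. \<forall>K. x \<in> outgrows r K h"
proof -
  have "\<exists>N>k. (real (Suc k) * (2 * real N) powr r) powr p / real N \<le> (1 / 2) ^ k" for k :: nat
  proof -
    have "(\<lambda>N. (real (Suc k) * 2 powr r) powr p * real N powr (r * p - 1)) \<longlonglongrightarrow>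
        (real (Suc k) * 2 powr r) powr p * 0"
      using rp by (intro tendsto_mult tendsto_const tendsto_neg_powr filterlim_real_sequentially) auto
    then have "\<forall>\<^sub>F N in sequentially.
        (real (Suc k) * 2 powr r) powr p * real N powr (r * p - 1) < (1 / 2) ^ k"
      by (rule order_tendstoD) simp
    with eventually_gt_at_top[of k]
    have "\<forall>\<^sub>F N in sequentially. N > k \<and>
        (real (Suc k) * (2 * real N) powr r) powr p / real N \<le> (1 / 2) ^ k"
    proof eventually_elim
      case (elim N)
      then have "0 < real N" by simp
      then have "(real (Suc k) * (2 * real N) powr r) powr p / real N =
          (real (Suc k) * 2 powr r) powr p * real N powr (r * p - 1)"
        by (simp add: powr_mult powr_powr powr_diff del: of_nat_Suc)
      then show ?case using elim by simp
    qed
    from eventually_happens'[OF sequentially_bot this] show ?thesis .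
  qed
  then obtain N :: "nat \<Rightarrow> nat" where N: "\<And>k. N k > k"
    "\<And>k. (real (Suc k) * (2 * real (N k)) powr r) powr p / real (N k) \<le> (1 / 2) ^ k"
    by metis
  \<comment> \<open>The visits to \<open>A k\<close> will be counted from time \<open>k + 1\<close> on, to have \<open>n > k\<close>. They occur at times
    \<open>n \<le> N k + k < 2 N k\<close>; this is the reason for the factor \<open>2\<close>.\<close>
  define c where "c k = real (Suc k) * (2 * real (N k)) powr r" for k
  have c0: "0 \<le> c k" for k by (simp add: c_def)
  have "\<exists>A\<in>sets M. real (N k) * prob A \<le> 1 \<and>
      1 - 1 / real (Suc k) < prob {x \<in> space M. \<exists>i<N k. (\<theta> ^^ i) x \<in> A}" for k
    using N(1)[of k] by (intro tower) auto
  then have "\<forall>k. \<exists>A. A \<in> sets M \<and> real (N k) * prob A \<le> 1 \<and>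
      1 - 1 / real (Suc k) < prob {x \<in> space M. \<exists>i<N k. (\<theta> ^^ i) x \<in> A}"
    by blast
  from choice[OF this]
  obtain A where A [measurable]: "\<And>k. A k \<in> sets M" and NA: "\<And>k. real (N k) * prob (A k) \<le> 1"
    and cover: "\<And>k. 1 - 1 / real (Suc k) < prob {x \<in> space M. \<exists>i<N k. (\<theta> ^^ i) x \<in> A k}"
    by blast
  define G where "G x = (\<Sum>k. ennreal (c k powr p) * indicator (A k) x)" for x
  have [measurable]: "G \<in> borel_measurable M" unfolding G_def by measurable
  have "(\<integral>\<^sup>+x. G x \<partial>M) = (\<Sum>k. ennreal (c k powr p) * emeasure M (A k))"
    unfolding G_def by (subst nn_integral_suminf) (auto simp: nn_integral_cmult_indicator)
  also have "\<dots> \<le> (\<Sum>k. ennreal ((1 / 2) ^ k))"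
  proof (intro suminf_le summableI)
    fix k
    have "prob (A k) \<le> 1 / real (N k)" using NA[of k] N(1)[of k] by (simp add: field_simps)
    then have "c k powr p * prob (A k) \<le> c k powr p * (1 / real (N k))"
      by (rule mult_left_mono) simp
    also have "\<dots> \<le> (1 / 2) ^ k" using N(2)[of k] by (simp add: c_def)
    finally show "ennreal (c k powr p) * emeasure M (A k) \<le> ennreal ((1 / 2) ^ k)"
      by (simp add: emeasure_eq_measure ennreal_mult[symmetric] ennreal_leI)
  qed
  also have "\<dots> = ennreal (\<Sum>k. (1 / 2) ^ k)"
    by (rule suminf_ennreal2) (auto intro: summable_geometric)
  also have "\<dots> < \<infinity>" by simp
  finally have fin: "(\<integral>\<^sup>+x. G x \<partial>M) < \<infinity>" .
  then have G_fin: "AE x in M. G x \<noteq> \<infinity>" by (intro nn_integral_PInf_AE) auto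
  define h where "h x = enn2real (G x) powr (1 / p)" for x
  have [measurable]: "h \<in> borel_measurable M" unfolding h_def by measurable
  have hp: "norm (h x) powr p = enn2real (G x)" for x
    using p by (simp add: h_def powr_powr)
  have "integrable M (\<lambda>x. enn2real (G x))"
  proof (rule integrableI_nonneg)
    have "(\<integral>\<^sup>+x. ennreal (enn2real (G x)) \<partial>M) \<le> (\<integral>\<^sup>+x. G x \<partial>M)"
      by (intro nn_integral_mono) (simp add: ennreal_enn2real_if)
    then show "(\<integral>\<^sup>+x. ennreal (enn2real (G x)) \<partial>M) < \<infinity>" using fin by (rule le_less_trans)
  qed auto
  then have hL: "h \<in> Lp_fun p M" unfolding Lp_fun_def mem_Collect_eq hp by simp
  have c_le: "c k \<le> h x" if "x \<in> A k" "G x \<noteq> \<infinity>" for k x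
  proof -
    have "ennreal (c k powr p) = (\<Sum>j\<in>{k}. ennreal (c j powr p) * indicator (A j) x)"
      using that by simp
    also have "\<dots> \<le> G x" unfolding G_def by (rule sum_le_suminf) auto
    finally have "c k powr p \<le> enn2real (G x)"
      using that(2) by (metis enn2real_ennreal enn2real_mono infinity_ennreal_def powr_ge_zero top.not_eq_extremum)
    then have "(c k powr p) powr (1 / p) \<le> h x"
      unfolding h_def using p by (intro powr_mono2) auto
    then show ?thesis using p c0[of k] by (simp add: powr_powr)
  qed
  have "1 - 1 / real (Suc k) < prob (outgrows r k h)" for k
  proof -
    let ?C = "{x \<in> space M. \<exists>i<N k. (\<theta> ^^ i) x \<in> A k}"
    \<comment> \<open>Shifting time by \<open>k + 1\<close> keeps the measure of the covered set and makes all times exceed \<open>k\<close>.\<close>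
    have "prob ?C = prob ((\<theta> ^^ Suc k) -` ?C \<inter> space M)"
      by (rule prob_iterate_vimage[symmetric]) measurable
    also have "\<dots> \<le> prob (outgrows r k h)"
    proof (rule finite_measure_mono_AE)
      show "AE x in M. x \<in> (\<theta> ^^ Suc k) -` ?C \<inter> space M \<longrightarrow> x \<in> outgrows r k h"
        using AE_all_iterates[OF G_fin]
      proof eventually_elim
        case (elim x)
        show ?case
        proof
          assume "x \<in> (\<theta> ^^ Suc k) -` ?C \<inter> space M"
          then obtain i where i: "x \<in> space M" "i < N k" "(\<theta> ^^ i) ((\<theta> ^^ Suc k) x) \<in> A k" by blast
          define n where "n = i + Suc k"
          have nA: "(\<theta> ^^ n) x \<in> A k" using i(3) unfolding n_def funpow_add by simp
          have "real k * real n powr r \<le> real k * (2 * real (N k)) powr r"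
            using i(2) N(1)[of k] r by (intro mult_left_mono powr_mono2) (auto simp: n_def)
          also have "\<dots> < c k" using N(1)[of k] unfolding c_def by (intro mult_strict_right_mono) auto
          also have "\<dots> \<le> h ((\<theta> ^^ n) x)" using c_le[OF nA] elim by blast
          finally have "real k * real n powr r < norm (h ((\<theta> ^^ n) x))" by simp
          then show "x \<in> outgrows r k h"
            using i(1) unfolding outgrows_def by (auto intro!: exI[of _ n] simp: n_def)
        qed
      qed
    qed measurable
    finally show ?thesis using cover[of k] by linarith
  qed
  then have "AE x in M. \<forall>K. x \<in> outgrows r K h" by (intro outgrows_full) auto
  with hL show ?thesis by (rule that)
qed

section \<open>Approximation in Lp\<close>

text \<open>The truncations of \<open>g\<close> plus \<open>h / (n + 1)\<close> converge to \<open>g\<close> pointwise, hence in \<open>L\<^sup>p\<close> by dominated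
  convergence, and they keep the growth of \<open>h\<close> since the truncations are bounded.\<close>

lemma outgrowing_approximates:
  fixes g :: "'a \<Rightarrow> 'b::{real_normed_field, second_countable_topology}" and h :: "'a \<Rightarrow> real"
  assumes r: "0 < r" and p: "1 \<le> p" and g: "g \<in> Lp_fun p M" and h: "h \<in> Lp_fun p M"
    and grow: "AE x in M. \<forall>K. x \<in> outgrows r K h" and "0 < \<epsilon>"
  shows "\<exists>f\<in>Lp_fun p M. Lp_norm p M (\<lambda>x. g x - f x) < \<epsilon> \<and> (AE x in M. \<forall>K. x \<in> outgrows r K f)"
proof -
  have [measurable]: "g \<in> borel_measurable M" "h \<in> borel_measurable M"
    using g h by (auto simp: Lp_fun_def)
  define b where "b n x = (if norm (g x) \<le> real n then g x else 0)" for n :: nat and x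
  define f where "f n x = b n x + of_real (1 / real (Suc n) * h x)" for n x
  \<comment> \<open>One function dominates both the approximants and their errors.\<close>
  define w where "w x = (norm (g x) + norm (h x)) powr p" for x
  have [measurable]: "f n \<in> borel_measurable M" for n unfolding f_def b_def by measurable
  have bb: "norm (b n x) \<le> real n" for n x by (simp add: b_def)
  have nL: "(\<lambda>x. norm (g x)) \<in> Lp_fun p M" "(\<lambda>x. norm (h x)) \<in> Lp_fun p M"
    using g h by (auto simp: Lp_fun_def)
  have w: "integrable M w"
    using Lp_minkowski(1)[OF p nL] by (simp add: Lp_fun_def w_def[abs_def])
  have small: "norm (1 / real (Suc n) * h x) \<le> norm (h x)" for n x
    by (simp add: abs_mult divide_le_eq mult_le_cancel_left1)
  have of_real_norm: "norm (of_real (1 / real (Suc n) * h x) :: 'b) = norm (1 / real (Suc n) * h x)" for n x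
    by (rule norm_of_real[THEN trans]) simp
  have f_le: "norm (f n x) powr p \<le> w x" for n x
    unfolding w_def
  proof (rule powr_mono2)
    have "norm (f n x) \<le> norm (b n x) + norm (of_real (1 / real (Suc n) * h x) :: 'b)"
      unfolding f_def by (rule norm_triangle_ineq)
    moreover have "norm (b n x) \<le> norm (g x)" by (simp add: b_def)
    ultimately show "norm (f n x) \<le> norm (g x) + norm (h x)"
      using small[of n x] of_real_norm[of n x] by linarith
  qed (use p in auto)
  have d_le: "norm (g x - f n x) powr p \<le> w x" for n x
    unfolding w_def
  proof (rule powr_mono2)
    have "norm (g x - f n x) \<le> norm (g x - b n x) + norm (of_real (1 / real (Suc n) * h x) :: 'b)"
      unfolding f_def diff_diff_eq[symmetric] by (rule norm_triangle_ineq4)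
    moreover have "norm (g x - b n x) \<le> norm (g x)" by (simp add: b_def)
    ultimately show "norm (g x - f n x) \<le> norm (g x) + norm (h x)"
      using small[of n x] of_real_norm[of n x] by linarith
  qed (use p in auto)
  have fL: "f n \<in> Lp_fun p M" for n
    unfolding Lp_fun_def using Bochner_Integration.integrable_bound[OF w, of "\<lambda>x. norm (f n x) powr p"] f_le
    by (auto simp: w_def)
  have pt: "(\<lambda>n. norm (g x - f n x) powr p) \<longlonglongrightarrow> 0" for x
  proof -
    have "\<forall>\<^sub>F n in sequentially. norm (1 / real (Suc n) * h x) = norm (g x - f n x)"
      using eventually_ge_at_top[of "nat \<lceil>norm (g x)\<rceil>"]
    proof eventually_elim
      case (elim n)
      then have "norm (g x) \<le> real n" by linarith
      then show ?case using of_real_norm[of n x] by (simp add: f_def b_def)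
    qed
    moreover have "(\<lambda>n. norm (1 / real (Suc n) * h x)) \<longlonglongrightarrow> norm (0 * h x)"
      by (intro tendsto_norm tendsto_mult tendsto_const lim_1_over_n[THEN LIMSEQ_Suc])
    ultimately have "(\<lambda>n. norm (g x - f n x)) \<longlonglongrightarrow> 0"
      using tendsto_cong by fastforce
    then have "(\<lambda>n. norm (g x - f n x) powr p) \<longlonglongrightarrow> 0 powr p"
      using p by (intro tendsto_powr') auto
    then show ?thesis using p by simp
  qed
  have "(\<lambda>n. \<integral>x. norm (g x - f n x) powr p \<partial>M) \<longlonglongrightarrow> (\<integral>x. 0 \<partial>M)"
    by (rule integral_dominated_convergence[OF _ _ w]) (use pt d_le in auto)
  then have "(\<lambda>n. \<integral>x. norm (g x - f n x) powr p \<partial>M) \<longlonglongrightarrow> 0" by simp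
  then have "\<forall>\<^sub>F n in sequentially. (\<integral>x. norm (g x - f n x) powr p \<partial>M) < \<epsilon> powr p"
    by (rule order_tendstoD) (use \<open>0 < \<epsilon>\<close> in simp)
  then obtain n where n: "(\<integral>x. norm (g x - f n x) powr p \<partial>M) < \<epsilon> powr p"
    by (auto simp: eventually_sequentially)
  have "Lp_norm p M (\<lambda>x. g x - f n x) < \<epsilon>"
    using n p \<open>0 < \<epsilon>\<close> Lp_norm_powr[OF p, of M "\<lambda>x. g x - f n x"]
      powr_mono2[of p \<epsilon> "Lp_norm p M (\<lambda>x. g x - f n x)"]
    by (auto simp: not_less[symmetric])
  moreover have "AE x in M. \<forall>K. x \<in> outgrows r K (f n)"
    using grow
  proof eventually_elim
    case (elim x)
    show ?case
      unfolding f_def using outgrows_perturb[OF r _ bb elim, of "1 / real (Suc n)"] by simp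
  qed
  ultimately show ?thesis using fL by blast
qed

end

section \<open>The dense \<open>G\<^sub>\<delta>\<close> set\<close>

theorem proposition2p12:
  fixes M :: "'a measure" and \<theta> :: "'a \<Rightarrow> 'a" and r p :: real
  assumes "lebesgue_space M"
    and "measure_preserving M \<theta>"
    and "ergodic M \<theta>"
    and "aperiodic M \<theta>"
    and "0 < r" and "r < 1"
    and "1 \<le> p" and "p < 1 / r"
  shows "\<exists>F :: ('a \<Rightarrow> 'b::{real_normed_field, banach, second_countable_topology}) set set.
           gdelta_in (Lp_topology p M) F \<and>
           (Lp_topology p M) closure_of F = Lp p M \<and>
           (\<forall>u\<in>F. \<forall>h\<in>u. AE x in M.
              limsup (\<lambda>n. ereal (norm ((koopman \<theta> ^^ n) h x) / real n powr r)) = \<infinity>)"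
proof -
  interpret prob_space M using assms(1) by (simp add: lebesgue_space_def)
  interpret probability_preserving M \<theta> by unfold_locales (rule assms(2))
  interpret Metric_space "Lp p M :: ('a \<Rightarrow> 'b) set set" "Lp_dist p M"
    by (rule Metric_space_Lp[OF assms(7)])
  note p = \<open>1 \<le> p\<close>
  have top: "Lp_topology p M = mtopology" by (simp add: Lp_topology_def)
  \<comment> \<open>Quantifying over all representatives \<open>h\<close> of \<open>u\<close> is harmless: almost everywhere equal functions
    stay so along almost every orbit.\<close>
  define U :: "nat \<Rightarrow> ('a \<Rightarrow> 'b) set set" where
    "U K = {u \<in> Lp p M. \<forall>h\<in>u. 1 - 1 / real (Suc K) < prob (outgrows r K h)}" for K
  have "openin mtopology (U K)" for K
    unfolding openin_mtopology
  proof (intro conjI allI impI)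
    fix u assume u: "u \<in> U K"
    then have uL: "u \<in> Lp p M" by (simp add: U_def)
    then obtain h where h: "h \<in> u" using Lp_class_nonempty by blast
    then have hL: "h \<in> Lp_fun p M" using uL Lp_class_subset by blast
    have "1 - 1 / real (Suc K) < prob (outgrows r K h)" using u h by (simp add: U_def)
    from outgrows_open[OF p hL this] obtain \<eta> where \<eta>: "\<eta> > 0"
      "\<And>h'. h' \<in> Lp_fun p M \<Longrightarrow> Lp_norm p M (\<lambda>x. h x - h' x) < \<eta> \<Longrightarrow>
        1 - 1 / real (Suc K) < prob (outgrows r K h')" by blast
    have "mball u \<eta> \<subseteq> U K"
    proof
      fix v assume v: "v \<in> mball u \<eta>"
      then have vL: "v \<in> Lp p M" by simp
      have "1 - 1 / real (Suc K) < prob (outgrows r K h')" if "h' \<in> v" for h'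
        using \<eta>(2)[of h'] v that Lp_dist_eq[OF uL vL h that] Lp_class_subset[OF vL] by auto
      then show "v \<in> U K" using vL by (simp add: U_def)
    qed
    then show "\<exists>\<eta>>0. mball u \<eta> \<subseteq> U K" using \<eta>(1) by blast
  qed (auto simp: U_def)
  then have gdelta: "gdelta_in (Lp_topology p M) (\<Inter>K. U K)"
    unfolding top by (intro gdelta_in_Inter) (auto intro: open_imp_gdelta_in)
  have "r * p < 1" using assms by (simp add: field_simps)
  have "\<exists>A\<in>sets M. real N * prob A \<le> 1 \<and> 1 - \<epsilon> < prob {x \<in> space M. \<exists>i<N. (\<theta> ^^ i) x \<in> A}"
    if "0 < N" "0 < \<epsilon>" for N \<epsilon>
    by (rule rokhlin_tower[OF assms(3) lebesgue_space_small_sets[OF assms(1,2,4)] that]) blast+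
  from exists_outgrowing[OF this \<open>0 < r\<close> p \<open>r * p < 1\<close>]
  obtain h :: "'a \<Rightarrow> real" where h: "h \<in> Lp_fun p M" "AE x in M. \<forall>K. x \<in> outgrows r K h" by metis
  have "mtopology closure_of (\<Inter>K. U K) = Lp p M"
    unfolding metric_closure_of
  proof (intro set_eqI iffI CollectI conjI allI impI)
    fix u :: "('a \<Rightarrow> 'b) set" and \<epsilon> :: real assume u: "u \<in> Lp p M" and \<epsilon>: "0 < \<epsilon>"
    obtain g where g: "g \<in> u" using Lp_class_nonempty[OF u] by blast
    then have "g \<in> Lp_fun p M" using Lp_class_subset[OF u] by blast
    from outgrowing_approximates[OF \<open>0 < r\<close> p this h \<epsilon>] obtain f where f: "f \<in> Lp_fun p M"
      "Lp_norm p M (\<lambda>x. g x - f x) < \<epsilon>" "AE x in M. \<forall>K. x \<in> outgrows r K f" by blast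
    define v where "v = AE_rel p M `` {f}"
    have v: "v \<in> Lp p M" unfolding v_def Lp_def by (rule quotientI[OF f(1)])
    have fv: "f \<in> v" unfolding v_def by (rule equiv_class_self[OF equiv_AE_rel f(1)])
    have "1 - 1 / real (Suc K) < prob (outgrows r K f')" if f': "f' \<in> v" for f' K
    proof -
      have [measurable]: "f' \<in> borel_measurable M"
        using f' Lp_class_subset[OF v] by (auto simp: Lp_fun_def)
      have "AE x in M. f x = f' x" by (rule Lp_class_AE[OF v fv f'])
      from AE_all_iterates[OF this] f(3) have "AE x in M. x \<in> outgrows r K f'"
        by eventually_elim (auto simp: outgrows_def)
      then have "prob (outgrows r K f') = 1" by (subst prob_eq_1) auto
      then show ?thesis by simp
    qed
    then have "v \<in> (\<Inter>K. U K)" using v by (auto simp: U_def)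
    moreover have "v \<in> mball u \<epsilon>" using u v f(2) Lp_dist_eq[OF u v g fv] by simp
    ultimately show "\<exists>v\<in>\<Inter>K. U K. v \<in> mball u \<epsilon>" by blast
  qed auto
  moreover have "AE x in M. limsup (\<lambda>n. ereal (norm ((koopman \<theta> ^^ n) h x) / real n powr r)) = \<infinity>"
    if u: "u \<in> (\<Inter>K. U K)" and h: "h \<in> u" for u and h :: "'a \<Rightarrow> 'b"
  proof -
    have "u \<in> Lp p M" using u by (auto simp: U_def)
    then have "h \<in> borel_measurable M" using h Lp_class_subset by (auto simp: Lp_fun_def)
    moreover have "1 - 1 / real (Suc K) < prob (outgrows r K h)" for K
      using u h by (auto simp: U_def)
    ultimately have "AE x in M. \<forall>K. x \<in> outgrows r K h" by (rule outgrows_full)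
    then show ?thesis by eventually_elim (rule outgrows_limsup)
  qed
  ultimately show ?thesis using gdelta unfolding top by (intro exI[of _ "\<Inter>K. U K"]) simp
qed

end
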